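(* For every $\boldsymbol{x}\in\Delta^K$ the following minimax equality holds: $$\max_{\boldsymbol{\lambda}\in\Delta^m}\ \max_{i=1,\dots,n+1}\ \min_{v\in\mathbb{R}}\ \sum_{j=1}^m\lambda_j\Psi^i_j(\boldsymbol{x},v)=\min_{\boldsymbol{v}\in\mathbb{R}^{n+1}}\ \max_{j=1,\dots,m}\ \max_{i=1,\dots,n+1}\Psi^i_j(\boldsymbol{x},v^i),$$ where $\boldsymbol{v}=(v^1,\dots,v^{n+1})$. In particular, for given $\mu\in\mathbb{R}$, the problem $$\min_{\boldsymbol{x}\in\Delta^K_{mix}(\mu)}\ \max_{\boldsymbol{\lambda}\in\Delta^m}\ \max_{i=1,\dots,n+1}\ \min_{v\in\mathbb{R}}\ \sum_{j=1}^m\lambda_j\Psi^i_j(\boldsymbol{x},v)$$ can be equivalently written as $$\min_{\boldsymbol{x}\in\Delta^K_{mix}(\mu)}\ \min_{\boldsymbol{v}\in\mathbb{R}^{n+1}}\ \max_{j=1,\dots,m}\ \max_{i=1,\dots,n+1}\Psi^i_j(\boldsymbol{x},v^i).$$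
   Context: Let $(\Omega,\mathcal{F})$ be a measurable space, let $K,m\ge 1$ be integers, let $\mathbb{P}_1,\dots,\mathbb{P}_m$ be probability measures on $(\Omega,\mathcal{F})$, with expectations $\mathbb{E}_{\mathbb{P}_1},\dots,\mathbb{E}_{\mathbb{P}_m}$, and let $R^1,\dots,R^K,Z:\Omega\to\mathbb{R}$ be measurable functions that are integrable under each $\mathbb{P}_j$, $j=1,\dots,m$. Superscripts on $R^k,x^k,v^i,\Psi^i_j$ are indices, not powers. Let $n\in\mathbb{N}_0$, and let $0\le\alpha_1<\cdots<\alpha_{n+1}\le 1$ and $0<r_1<\cdots<r_n<r_{n+1}=1$, where $\alpha_1>0$ is implicit in the requirement that the functions $\Psi^i_j$ below, which contain the factor $1/\alpha_i$, be real-valued. For an integer $d\ge 1$ let $\Delta^d$ be the set of vectors in $\mathbb{R}^d$ with nonnegative components summing to $1$. For $\mu\in\mathbb{R}$ let $$\Delta^K_{mix}(\mu):=\left\{\boldsymbol{x}\in\Delta^K : \min_{j=1,\dots,m}\sum_{k=1}^K x^k\,\mathbb{E}_{\mathbb{P}_j}(R^k)\ge\mu\right\}.$$ For $i=1,\dots,n+1$, $j=1,\dots,m$ and $\boldsymbol{x}\in\Delta^K$ define the function $\Psi^i_j(\boldsymbol{x},\cdot):\mathbb{R}\to\mathbb{R}$ by $$\Psi^i_j(\boldsymbol{x},v):=\frac{1}{\alpha_i}\,\mathbb{E}_{\mathbb{P}_j}\left(\max\left\{v-\sum_{k=1}^K x^kR^k+r_iZ,\,0\right\}\right)-v.$$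
   Formalization: If α_{n+1}=1 the minimum over v may fail to exist (e.g. n=0, Z=0, R unbounded above), so the minima over v and over the vector v are infima; attainment over v is shown for levels with α_i<1, and over the vector when α_{n+1}<1. *)

theory Defs
  imports "HOL-Probability.Probability"
begin

definition prob_simplex :: "(real ^ 'd) set" where
  "prob_simplex = {x. (\<forall>k. 0 \<le> x $ k) \<and> (\<Sum>k\<in>UNIV. x $ k) = 1}"

definition simplex_mix ::
  "('m::finite \<Rightarrow> 'a measure) \<Rightarrow> ('k \<Rightarrow> 'a \<Rightarrow> real) \<Rightarrow> real \<Rightarrow> (real ^ 'k) set" where
  "simplex_mix P R \<mu> =
     {x \<in> prob_simplex. (MIN j\<in>UNIV. \<Sum>k\<in>UNIV. x $ k * (\<integral>\<omega>. R k \<omega> \<partial>P j)) \<ge> \<mu>}"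

definition Psi ::
  "('m \<Rightarrow> 'a measure) \<Rightarrow> ('k \<Rightarrow> 'a \<Rightarrow> real) \<Rightarrow> ('a \<Rightarrow> real) \<Rightarrow> (nat \<Rightarrow> real) \<Rightarrow> (nat \<Rightarrow> real)
    \<Rightarrow> nat \<Rightarrow> 'm \<Rightarrow> real ^ 'k \<Rightarrow> real \<Rightarrow> real" where
  "Psi P R Z \<alpha> r i j x v =
     1 / \<alpha> i * (\<integral>\<omega>. max (v - (\<Sum>k\<in>UNIV. x $ k * R k \<omega>) + r i * Z \<omega>) 0 \<partial>P j) - v"

text \<open>Optimal values are taken in the extended reals, so that the infimum over an empty feasible
  set is \<open>\<infinity>\<close> and the infimum of an unbounded family is never an arbitrary real.  The minimum over
  \<open>v\<close> is an infimum because it need not be attained when \<open>\<alpha> i = 1\<close>.\<close>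

definition max_min_objective ::
  "('m \<Rightarrow> 'a measure) \<Rightarrow> ('k \<Rightarrow> 'a \<Rightarrow> real) \<Rightarrow> ('a \<Rightarrow> real) \<Rightarrow> (nat \<Rightarrow> real) \<Rightarrow> (nat \<Rightarrow> real)
    \<Rightarrow> nat \<Rightarrow> real ^ 'k \<Rightarrow> real ^ 'm \<Rightarrow> ereal" where
  "max_min_objective P R Z \<alpha> r n x w =
     (MAX i\<in>{1..n+1}. INF v. ereal (\<Sum>j\<in>UNIV. w $ j * Psi P R Z \<alpha> r i j x v))"

definition min_max_objective ::
  "('m::finite \<Rightarrow> 'a measure) \<Rightarrow> ('k \<Rightarrow> 'a \<Rightarrow> real) \<Rightarrow> ('a \<Rightarrow> real) \<Rightarrow> (nat \<Rightarrow> real) \<Rightarrow> (nat \<Rightarrow> real)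
    \<Rightarrow> nat \<Rightarrow> real ^ 'k \<Rightarrow> (nat \<Rightarrow> real) \<Rightarrow> real" where
  "min_max_objective P R Z \<alpha> r n x v =
     (MAX j\<in>UNIV. MAX i\<in>{1..n+1}. Psi P R Z \<alpha> r i j x (v i))"

text \<open>The space \<open>\<real>\<^sup>d\<close> with coordinates indexed by \<open>1, \<dots>, d\<close>.\<close>

definition vectors :: "nat \<Rightarrow> (nat \<Rightarrow> real) set" where
  "vectors d = {1..d} \<rightarrow>\<^sub>E UNIV"

end

theory Submission imports Defs begin

text \<open>For fixed \<open>x\<close> the functions \<open>Psi\<close> are finite, convex and bounded below in \<open>v\<close>.  If \<open>c\<close> denotes
  the min-max value, then some level \<open>i\<close> satisfies \<open>c \<le> max\<^sub>j Psi i j v\<close> for all \<open>v\<close>, because the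
  coordinates of \<open>v\<close> can be chosen independently.  Separating the orthant \<open>{y. \<forall>j. y\<^sub>j < c}\<close> from
  \<open>{y. \<exists>v. \<forall>j. Psi i j v \<le> y\<^sub>j}\<close> by a hyperplane yields weights \<open>w\<close> that attain \<open>c\<close> on the max-min
  side.  Minimisers in \<open>v\<close> exist by coercivity when \<open>\<alpha> i < 1\<close>, and minimisers in \<open>x\<close> exist because
  the value is Lipschitz in \<open>x\<close> on a compact set: \<open>Psi\<close> is Lipschitz in \<open>x\<close> uniformly in \<open>v\<close>.\<close>

section \<open>Minimax for finitely many convex functions, by separation\<close>

text \<open>The separation takes place in the finite-dimensional space \<open>real^'m\<close> of
  value vectors, so \<open>'v\<close> may be any real vector space. The weights are the normal
  vector of the hyperplane, scaled to sum 1.\<close>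

lemma convex_minimax:
  fixes f :: "'m::finite \<Rightarrow> 'v::real_vector \<Rightarrow> real"
  assumes conv: "\<And>j. convex_on UNIV (f j)"
    and lower: "\<And>v. \<exists>j. c \<le> f j v"
  obtains w where "w \<in> prob_simplex" "\<And>v. c \<le> (\<Sum>j\<in>UNIV. w $ j * f j v)"
proof -
  define D where "D = {y::real^'m. \<forall>j. y $ j < c}"
  \<comment> \<open>The set of value vectors \<open>f j v\<close> alone is in general not convex.
    Adding everything above it repairs this.\<close>
  define C where "C = {y::real^'m. \<exists>v. \<forall>j. f j v \<le> y $ j}"
  have "convex D"
    unfolding D_def convex_def by (auto intro!: convex_bound_lt)
  moreover have "convex C"
  proof (rule convexI)
    fix y z :: "real^'m" and s t :: real
    assume yz: "y \<in> C" "z \<in> C" and st: "0 \<le> s" "0 \<le> t" "s + t = 1"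
    obtain u v where u: "\<And>j. f j u \<le> y $ j" and v: "\<And>j. f j v \<le> z $ j"
      using yz by (auto simp: C_def)
    have "f j (s *\<^sub>R u + t *\<^sub>R v) \<le> (s *\<^sub>R y + t *\<^sub>R z) $ j" for j
    proof -
      have "f j (s *\<^sub>R u + t *\<^sub>R v) \<le> s * f j u + t * f j v"
        using conv[of j] st by (auto simp: convex_on_def)
      also have "\<dots> \<le> s * y $ j + t * z $ j"
        by (intro add_mono mult_left_mono u v st)
      finally show ?thesis by simp
    qed
    then show "s *\<^sub>R y + t *\<^sub>R z \<in> C" by (auto simp: C_def)
  qed
  moreover have mem_D: "(\<chi> k. c - e k) \<in> D" if "\<And>k. e k > 0" for e
    using that by (auto simp: D_def)
  moreover have mem_C: "(\<chi> j. f j v) \<in> C" for v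
    by (auto simp: C_def)
  moreover have "D \<inter> C = {}"
  proof -
    have False if y: "\<And>j. y $ j < c" "\<And>j. f j v \<le> y $ j" for y v
      using lower[of v] y by (meson dual_order.trans not_le)
    then show ?thesis by (auto simp: D_def C_def)
  qed
  moreover have "D \<noteq> {}" "C \<noteq> {}"
    using mem_D[of "\<lambda>_. 1"] mem_C by auto
  ultimately obtain a b where "a \<noteq> 0" and ab: "\<And>y. y \<in> D \<Longrightarrow> a \<bullet> y \<le> b" "\<And>y. y \<in> C \<Longrightarrow> b \<le> a \<bullet> y"
    using separating_hyperplane_sets[of D C] by metis
  have a_nonneg: "0 \<le> a $ j" for j
  proof (rule ccontr)
    assume neg: "\<not> 0 \<le> a $ j"
    define S where "S = (c - 1) * (\<Sum>k\<in>UNIV. a $ k)"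
    \<comment> \<open>\<open>D\<close> is unbounded below in every coordinate. Lowering coordinate
      \<open>j\<close> by this \<open>t\<close> from the point with all entries \<open>c - 1\<close>
      raises the inner product from \<open>S\<close> to \<open>S + \<bar>b - S\<bar> + 1\<close>,
      which exceeds \<open>b\<close>.\<close>
    define t where "t = (\<bar>b - S\<bar> + 1) / (- a $ j)"
    have t: "t > 0" "t * a $ j = - (\<bar>b - S\<bar> + 1)"
      using neg by (auto simp: t_def field_simps)
    have "a \<bullet> (\<chi> k. c - (if k = j then 1 + t else 1)) \<le> b"
      using t by (intro ab mem_D) auto
    also have "a \<bullet> (\<chi> k. c - (if k = j then 1 + t else 1))
        = (\<Sum>k\<in>UNIV. (c - 1) * a $ k - (if k = j then t * a $ j else 0))"
      unfolding inner_vec_def by (intro sum.cong) (auto simp: algebra_simps)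
    also have "\<dots> = S - t * a $ j"
      by (simp add: S_def sum_subtractf sum_distrib_left)
    finally show False using t by linarith
  qed
  define s where "s = (\<Sum>k\<in>UNIV. a $ k)"
  have "s > 0"
  proof -
    obtain k where "a $ k \<noteq> 0" using \<open>a \<noteq> 0\<close> by (auto simp: vec_eq_iff)
    then have "a $ k > 0" using a_nonneg[of k] by linarith
    then show ?thesis unfolding s_def by (intro sum_pos2[where i = k]) (auto simp: a_nonneg)
  qed
  \<comment> \<open>The point with all entries \<open>c\<close> lies on the boundary of
    \<open>D\<close>. It is approached from inside, and the shift \<open>e / s\<close> costs exactly
    \<open>e\<close> in the inner product.\<close>
  have "c * s \<le> b"
  proof (rule field_le_epsilon)
    fix e :: real assume "e > 0"
    have "a \<bullet> (\<chi> k. c - e / s) \<le> b"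
      using \<open>e > 0\<close> \<open>s > 0\<close> by (intro ab mem_D) auto
    moreover have "a \<bullet> (\<chi> k. c - e / s) = s * (c - e / s)"
      by (simp add: inner_vec_def s_def sum_distrib_right)
    moreover have "s * (c - e / s) = c * s - e" using \<open>s > 0\<close> by (simp add: field_simps)
    ultimately show "c * s \<le> b + e" by simp
  qed
  show ?thesis
  proof
    show "(\<chi> j. a $ j / s) \<in> prob_simplex"
      using a_nonneg \<open>s > 0\<close> by (auto simp: prob_simplex_def s_def simp flip: sum_divide_distrib)
    fix v
    have "c * s \<le> (\<Sum>j\<in>UNIV. a $ j * f j v)"
      using \<open>c * s \<le> b\<close> ab(2)[OF mem_C[of v]] by (simp add: inner_vec_def)
    then have "c \<le> (\<Sum>j\<in>UNIV. a $ j * f j v) / s"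
      using \<open>s > 0\<close> by (simp add: field_simps)
    then show "c \<le> (\<Sum>j\<in>UNIV. (\<chi> j. a $ j / s) $ j * f j v)"
      by (simp add: sum_divide_distrib)
  qed
qed

section \<open>Attainment on the real line and properties of the simplex\<close>

lemma continuous_on_Max:
  fixes f :: "'i \<Rightarrow> 'x::topological_space \<Rightarrow> 'y::linorder_topology"
  assumes "finite I" "I \<noteq> {}" "\<And>i. i \<in> I \<Longrightarrow> continuous_on S (f i)"
  shows "continuous_on S (\<lambda>x. MAX i\<in>I. f i x)"
  using assms
proof (induction I rule: finite_ne_induct)
  case (insert i I)
  then show ?case by (simp add: continuous_on_max)
qed simp

text \<open>Outside \<open>{-B..B}\<close> the two linear bounds already exceed \<open>f 0\<close>,
  so a minimiser on this compact interval is global. The first term of \<open>B\<close> serves the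
  left side, the second the right side.\<close>

lemma coercive_attains_inf:
  fixes f :: "real \<Rightarrow> real"
  assumes cont: "continuous_on UNIV f" and "0 < a"
    and left: "\<And>v. - v \<le> f v" and right: "\<And>v. a * v - C \<le> f v"
  obtains v where "\<And>u. f v \<le> f u"
proof -
  define B where "B = max \<bar>f 0\<bar> (\<bar>f 0 + C\<bar> / a)"
  have "0 \<le> B" by (auto simp: B_def)
  have "\<exists>v\<in>{-B..B}. \<forall>u\<in>{-B..B}. f v \<le> f u"
    using \<open>0 \<le> B\<close> by (intro continuous_attains_inf continuous_on_subset[OF cont]) auto
  then obtain v where v: "\<And>u. u \<in> {-B..B} \<Longrightarrow> f v \<le> f u" by blast
  have "f v \<le> f 0" using \<open>0 \<le> B\<close> by (intro v) auto
  have "f v \<le> f u" for u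
  proof -
    consider "u \<in> {-B..B}" | "u < - B" | "B < u" by force
    then show ?thesis
    proof cases
      case 2
      then have "f 0 \<le> f u" using left[of u] by (auto simp: B_def)
      then show ?thesis using \<open>f v \<le> f 0\<close> by linarith
    next
      case 3
      then have "\<bar>f 0 + C\<bar> / a < u" by (auto simp: B_def)
      then have "\<bar>f 0 + C\<bar> < a * u" using \<open>0 < a\<close> by (simp add: field_simps)
      then have "f 0 \<le> f u" using right[of u] by linarith
      then show ?thesis using \<open>f v \<le> f 0\<close> by linarith
    qed (rule v)
  qed
  then show ?thesis by (rule that)
qed

lemma prob_simplex_sum_mono:
  fixes w :: "real^'m::finite"
  assumes "w \<in> prob_simplex" "\<And>j. g j \<le> h j"
  shows "(\<Sum>j\<in>UNIV. w $ j * g j) \<le> (\<Sum>j\<in>UNIV. w $ j * h j)"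
  using assms by (intro sum_mono mult_left_mono) (auto simp: prob_simplex_def)

lemma prob_simplex_sum_const:
  fixes w :: "real^'m::finite"
  assumes "w \<in> prob_simplex"
  shows "(\<Sum>j\<in>UNIV. w $ j * c) = c"
  using assms by (simp add: prob_simplex_def flip: sum_distrib_right)

text \<open>A bound on the minimum over \<open>j\<close> is a bound for every \<open>j\<close>, so
  the set is an intersection of closed half-spaces and a hyperplane. It is bounded because
  nonnegative entries with sum 1 have l1 norm 1.\<close>

lemma compact_simplex_mix:
  fixes P :: "'m::finite \<Rightarrow> 'a measure" and R :: "'k::finite \<Rightarrow> 'a \<Rightarrow> real"
  shows "compact (simplex_mix P R \<mu>)"
proof -
  have "simplex_mix P R \<mu> = (\<Inter>k. {x. 0 \<le> x $ k}) \<inter> {x. (\<Sum>k\<in>UNIV. x $ k) = 1}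
      \<inter> (\<Inter>j. {x. \<mu> \<le> (\<Sum>k\<in>UNIV. x $ k * (\<integral>\<omega>. R k \<omega> \<partial>P j))})"
    by (auto simp: simplex_mix_def prob_simplex_def)
  moreover have "closed \<dots>"
    by (intro closed_Int closed_INT ballI closed_Collect_le closed_Collect_eq continuous_intros)
  moreover have "bounded (simplex_mix P R \<mu>)"
  proof -
    have "norm x \<le> 1" if "x \<in> simplex_mix P R \<mu>" for x
    proof -
      have "norm x \<le> (\<Sum>k\<in>UNIV. \<bar>x $ k\<bar>)" by (rule norm_le_l1_cart)
      also have "\<dots> = (\<Sum>k\<in>UNIV. x $ k)"
        using that by (intro sum.cong) (auto simp: simplex_mix_def prob_simplex_def)
      finally show ?thesis using that by (simp add: simplex_mix_def prob_simplex_def)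
    qed
    then show ?thesis by (auto simp: bounded_iff)
  qed
  ultimately show ?thesis by (simp add: compact_eq_bounded_closed)
qed

text \<open>The bounds on each \<open>\<alpha> i\<close> are what the final theorem derives from the
  ordering of the levels and the bounds at its two ends. The vector \<open>x\<close> is not fixed,
  so that the dependence on it can be studied.\<close>

locale scenario_model =
  fixes P :: "'m::finite \<Rightarrow> 'a measure"
    and R :: "'k::finite \<Rightarrow> 'a \<Rightarrow> real"
    and Z :: "'a \<Rightarrow> real"
    and \<alpha> r :: "nat \<Rightarrow> real"
    and n :: nat
  assumes prob: "\<And>j. prob_space (P j)"
    and R_int: "\<And>j k. integrable (P j) (R k)"
    and Z_int: "\<And>j. integrable (P j) Z"
    and \<alpha>_pos: "\<And>i. i \<in> {1..n+1} \<Longrightarrow> 0 < \<alpha> i"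
    and \<alpha>_le_1: "\<And>i. i \<in> {1..n+1} \<Longrightarrow> \<alpha> i \<le> 1"
begin

abbreviation "psi \<equiv> Psi P R Z \<alpha> r"
abbreviation "mm \<equiv> min_max_objective P R Z \<alpha> r n"
abbreviation "MM \<equiv> max_min_objective P R Z \<alpha> r n"

section \<open>Integrability, convexity and growth of \<open>Psi\<close>\<close>

lemma gain_integrable: "integrable (P j) (\<lambda>\<omega>. v - (\<Sum>k\<in>UNIV. x $ k * R k \<omega>) + r i * Z \<omega>)"
proof -
  interpret prob_space "P j" by (rule prob)
  show ?thesis
    by (intro Bochner_Integration.integrable_add Bochner_Integration.integrable_diff
        Bochner_Integration.integrable_sum integrable_mult_right integrable_const R_int Z_int)
qed

lemma excess_integrable:
  "integrable (P j) (\<lambda>\<omega>. max (v - (\<Sum>k\<in>UNIV. x $ k * R k \<omega>) + r i * Z \<omega>) 0)"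
  by (intro integrable_max gain_integrable) simp

text \<open>The positive part is convex and its argument is affine in \<open>v\<close>. Integration
  and division by the positive \<open>\<alpha> i\<close> preserve the inequality, and the remaining
  term \<open>- v\<close> is linear.\<close>

lemma psi_convex:
  assumes "i \<in> {1..n+1}"
  shows "convex_on UNIV (psi i j x)"
proof (rule convex_onI)
  fix t u v :: real assume t: "0 < t" "t < 1"
  let ?E = "\<lambda>v. \<integral>\<omega>. max (v - (\<Sum>k\<in>UNIV. x $ k * R k \<omega>) + r i * Z \<omega>) 0 \<partial>P j"
  have "?E ((1 - t) * u + t * v) \<le> (\<integral>\<omega>. (1 - t) * max (u - (\<Sum>k\<in>UNIV. x $ k * R k \<omega>) + r i * Z \<omega>) 0
      + t * max (v - (\<Sum>k\<in>UNIV. x $ k * R k \<omega>) + r i * Z \<omega>) 0 \<partial>P j)"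
  proof (rule integral_mono)
    fix \<omega>
    let ?W = "(\<Sum>k\<in>UNIV. x $ k * R k \<omega>) - r i * Z \<omega>"
    have "(1 - t) * u + t * v - ?W = (1 - t) * (u - ?W) + t * (v - ?W)"
      by (simp add: algebra_simps)
    also have "\<dots> \<le> (1 - t) * max (u - ?W) 0 + t * max (v - ?W) 0"
      using t by (intro add_mono mult_left_mono) auto
    finally have "max ((1 - t) * u + t * v - ?W) 0 \<le> (1 - t) * max (u - ?W) 0 + t * max (v - ?W) 0"
      using t by simp
    then show "max ((1 - t) * u + t * v - (\<Sum>k\<in>UNIV. x $ k * R k \<omega>) + r i * Z \<omega>) 0
        \<le> (1 - t) * max (u - (\<Sum>k\<in>UNIV. x $ k * R k \<omega>) + r i * Z \<omega>) 0
          + t * max (v - (\<Sum>k\<in>UNIV. x $ k * R k \<omega>) + r i * Z \<omega>) 0"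
      by (simp add: algebra_simps)
  qed (intro excess_integrable Bochner_Integration.integrable_add integrable_mult_right)+
  also have "\<dots> = (1 - t) * ?E u + t * ?E v"
    by (subst Bochner_Integration.integral_add) (auto intro!: excess_integrable)
  finally have "?E ((1 - t) * u + t * v) / \<alpha> i \<le> ((1 - t) * ?E u + t * ?E v) / \<alpha> i"
    using \<alpha>_pos[OF assms] by (intro divide_right_mono) auto
  then show "psi i j x ((1 - t) *\<^sub>R u + t *\<^sub>R v) \<le> (1 - t) * psi i j x u + t * psi i j x v"
    by (simp add: Psi_def algebra_simps add_divide_distrib diff_divide_distrib)
qed simp

lemma psi_continuous:
  assumes "i \<in> {1..n+1}"
  shows "continuous_on UNIV (psi i j x)"
  using convex_on_continuous[OF open_UNIV psi_convex[OF assms]] .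

text \<open>The integral of a positive part is nonnegative. This controls \<open>v\<close> tending
  to minus infinity.\<close>

lemma psi_ge_minus:
  assumes "i \<in> {1..n+1}"
  shows "- v \<le> psi i j x v"
  using \<alpha>_pos[OF assms] by (auto simp: Psi_def intro!: divide_nonneg_pos integral_nonneg_AE)

text \<open>A positive part dominates its argument, whose integral is affine in \<open>v\<close>.
  The slope is positive for \<open>\<alpha> i < 1\<close>, giving growth to the right, and vanishes
  for \<open>\<alpha> i = 1\<close>.\<close>

lemma psi_ge_linear:
  assumes "i \<in> {1..n+1}"
  shows "(1 / \<alpha> i - 1) * v + (\<integral>\<omega>. 0 - (\<Sum>k\<in>UNIV. x $ k * R k \<omega>) + r i * Z \<omega> \<partial>P j) / \<alpha> i
    \<le> psi i j x v"
proof -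
  interpret prob_space "P j" by (rule prob)
  let ?G = "\<lambda>v \<omega>. v - (\<Sum>k\<in>UNIV. x $ k * R k \<omega>) + r i * Z \<omega>"
  have "v + (\<integral>\<omega>. ?G 0 \<omega> \<partial>P j) = (\<integral>\<omega>. v + ?G 0 \<omega> \<partial>P j)"
    by (subst Bochner_Integration.integral_add[OF integrable_const gain_integrable])
      (simp add: prob_space)
  also have "\<dots> = (\<integral>\<omega>. ?G v \<omega> \<partial>P j)"
    by (intro Bochner_Integration.integral_cong) auto
  also have "\<dots> \<le> (\<integral>\<omega>. max (?G v \<omega>) 0 \<partial>P j)"
    by (intro integral_mono gain_integrable excess_integrable) auto
  finally have "(v + (\<integral>\<omega>. ?G 0 \<omega> \<partial>P j)) / \<alpha> i \<le> (\<integral>\<omega>. max (?G v \<omega>) 0 \<partial>P j) / \<alpha> i"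
    using \<alpha>_pos[OF assms] by (intro divide_right_mono) auto
  then show ?thesis by (simp add: Psi_def algebra_simps add_divide_distrib)
qed

text \<open>One pair of constants serves all scenarios \<open>j\<close>, so that weighted sums and
  maxima over \<open>j\<close> inherit the bound.\<close>

lemma psi_coercive:
  assumes "i \<in> {1..n+1}" "\<alpha> i < 1"
  obtains a C where "0 < a" "\<And>j v. a * v - C \<le> psi i j x v"
proof -
  define D where "D j = (\<integral>\<omega>. 0 - (\<Sum>k\<in>UNIV. x $ k * R k \<omega>) + r i * Z \<omega> \<partial>P j) / \<alpha> i" for j
  show ?thesis
  proof
    show "0 < 1 / \<alpha> i - 1" using assms \<alpha>_pos[of i] by simp
    show "(1 / \<alpha> i - 1) * v - (- Min (range D)) \<le> psi i j x v" for j v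
    proof -
      have "Min (range D) \<le> D j" by simp
      then show ?thesis
        using psi_ge_linear[OF assms(1), where v = v and x = x and j = j]
        unfolding D_def[symmetric] by linarith
    qed
  qed
qed

text \<open>For \<open>v \<le> 0\<close> the bound \<open>- v\<close> is at least 0; for
  \<open>v > 0\<close> the linear bound has nonnegative slope and stays above its constant term.
  This covers \<open>\<alpha> i = 1\<close> as well.\<close>

lemma psi_bounded_below:
  assumes "i \<in> {1..n+1}"
  obtains b where "\<And>v. b \<le> psi i j x v"
proof -
  define D where "D = (\<integral>\<omega>. 0 - (\<Sum>k\<in>UNIV. x $ k * R k \<omega>) + r i * Z \<omega> \<partial>P j) / \<alpha> i"
  have "min 0 D \<le> psi i j x v" for v
  proof (cases "v \<le> 0")
    case True
    then show ?thesis using psi_ge_minus[OF assms, of v j x] by simp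
  next
    case False
    then have "0 \<le> (1 / \<alpha> i - 1) * v"
      using \<alpha>_pos[OF assms] \<alpha>_le_1[OF assms] by (intro mult_nonneg_nonneg) auto
    then show ?thesis
      using psi_ge_linear[OF assms, where v = v and x = x and j = j] by (simp add: D_def)
  qed
  then show ?thesis by (rule that)
qed

text \<open>In the difference of the arguments at \<open>x\<close> and \<open>y\<close> the terms
  with \<open>v\<close> and \<open>Z\<close> cancel, and taking the positive part does not enlarge
  differences. Hence \<open>L\<close> is uniform in \<open>v\<close>; summing the constants over all
  \<open>i\<close> and \<open>j\<close> makes it uniform in these too.\<close>

lemma psi_Lipschitz:
  obtains L where "0 \<le> L"
    "\<And>i j x y v. i \<in> {1..n+1} \<Longrightarrow> psi i j x v \<le> psi i j y v + L * norm (x - y)"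
proof -
  define A where "A j = (\<integral>\<omega>. (\<Sum>k\<in>UNIV. \<bar>R k \<omega>\<bar>) \<partial>P j)" for j
  have A_nonneg: "0 \<le> A j" for j
    by (auto simp: A_def intro!: integral_nonneg_AE sum_nonneg)
  have row_nonneg: "0 \<le> (\<Sum>i\<in>{1..n+1}. A j / \<alpha> i)" for j
    by (rule sum_nonneg) (intro divide_nonneg_pos A_nonneg \<alpha>_pos)
  define L where "L = (\<Sum>j\<in>UNIV. \<Sum>i\<in>{1..n+1}. A j / \<alpha> i)"
  have bound: "psi i j x v \<le> psi i j y v + L * norm (x - y)" if i: "i \<in> {1..n+1}" for i j x y v
  proof -
    let ?G = "\<lambda>x \<omega>. v - (\<Sum>k\<in>UNIV. x $ k * R k \<omega>) + r i * Z \<omega>"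
    have abs_int: "integrable (P j) (\<lambda>\<omega>. norm (x - y) * (\<Sum>k\<in>UNIV. \<bar>R k \<omega>\<bar>))"
      by (intro integrable_mult_right Bochner_Integration.integrable_sum integrable_abs R_int)
    have "(\<integral>\<omega>. max (?G x \<omega>) 0 \<partial>P j)
        \<le> (\<integral>\<omega>. max (?G y \<omega>) 0 + norm (x - y) * (\<Sum>k\<in>UNIV. \<bar>R k \<omega>\<bar>) \<partial>P j)"
    proof (rule integral_mono)
      fix \<omega>
      have "?G x \<omega> - ?G y \<omega> = (\<Sum>k\<in>UNIV. - ((x - y) $ k * R k \<omega>))"
        by (simp add: algebra_simps sum_subtractf)
      also have "\<dots> \<le> (\<Sum>k\<in>UNIV. norm (x - y) * \<bar>R k \<omega>\<bar>)"
      proof (rule sum_mono)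
        fix k
        have "- ((x - y) $ k * R k \<omega>) \<le> \<bar>(x - y) $ k\<bar> * \<bar>R k \<omega>\<bar>"
          by (metis abs_ge_minus_self abs_mult)
        also have "\<dots> \<le> norm (x - y) * \<bar>R k \<omega>\<bar>"
          by (intro mult_right_mono component_le_norm_cart) auto
        finally show "- ((x - y) $ k * R k \<omega>) \<le> norm (x - y) * \<bar>R k \<omega>\<bar>" .
      qed
      finally have "?G x \<omega> \<le> ?G y \<omega> + norm (x - y) * (\<Sum>k\<in>UNIV. \<bar>R k \<omega>\<bar>)"
        by (simp add: sum_distrib_left)
      moreover have "0 \<le> norm (x - y) * (\<Sum>k\<in>UNIV. \<bar>R k \<omega>\<bar>)"
        by (intro mult_nonneg_nonneg sum_nonneg) auto
      ultimately show "max (?G x \<omega>) 0 \<le> max (?G y \<omega>) 0 + norm (x - y) * (\<Sum>k\<in>UNIV. \<bar>R k \<omega>\<bar>)"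
        by linarith
    qed (intro excess_integrable Bochner_Integration.integrable_add abs_int)+
    also have "\<dots> = (\<integral>\<omega>. max (?G y \<omega>) 0 \<partial>P j) + norm (x - y) * A j"
      by (subst Bochner_Integration.integral_add[OF excess_integrable abs_int]) (simp add: A_def)
    finally have "(\<integral>\<omega>. max (?G x \<omega>) 0 \<partial>P j) / \<alpha> i
        \<le> ((\<integral>\<omega>. max (?G y \<omega>) 0 \<partial>P j) + norm (x - y) * A j) / \<alpha> i"
      using \<alpha>_pos[OF i] by (intro divide_right_mono) auto
    then have "psi i j x v \<le> psi i j y v + A j / \<alpha> i * norm (x - y)"
      by (simp add: Psi_def add_divide_distrib algebra_simps)
    also have "A j / \<alpha> i \<le> (\<Sum>i\<in>{1..n+1}. A j / \<alpha> i)"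
      by (rule member_le_sum[OF i]) (auto intro!: divide_nonneg_pos A_nonneg \<alpha>_pos)
    also have "\<dots> \<le> L"
      unfolding L_def by (rule member_le_sum[OF UNIV_I row_nonneg finite])
    finally show ?thesis by (simp add: mult_right_mono)
  qed
  moreover have "0 \<le> L"
    unfolding L_def by (intro sum_nonneg row_nonneg)
  ultimately show ?thesis by (rule that[rotated])
qed

section \<open>Duality for fixed \<open>x\<close>\<close>

lemma mm_le_iff: "mm x v \<le> c \<longleftrightarrow> (\<forall>j. \<forall>i\<in>{1..n+1}. psi i j x (v i) \<le> c)"
  by (simp add: min_max_objective_def)

lemma mm_less_iff: "mm x v < c \<longleftrightarrow> (\<forall>j. \<forall>i\<in>{1..n+1}. psi i j x (v i) < c)"
  by (simp add: min_max_objective_def)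

lemma mm_ge: "i \<in> {1..n+1} \<Longrightarrow> psi i j x (v i) \<le> mm x v"
  using mm_le_iff[of x v "mm x v"] by blast

lemma primal_value:
  "\<exists>c. (INF v\<in>vectors (n+1). ereal (mm x v)) = ereal c"
proof -
  \<comment> \<open>A single function below the maximum suffices: level 1 always exists, and
    \<open>undefined\<close> stands for an arbitrary scenario.\<close>
  obtain b where b: "\<And>v. b \<le> psi 1 undefined x v"
    using psi_bounded_below[of 1] by auto
  have "ereal b \<le> (INF v\<in>vectors (n+1). ereal (mm x v))"
    by (intro INF_greatest) (auto intro!: order_trans[OF b mm_ge])
  moreover have "(INF v\<in>vectors (n+1). ereal (mm x v)) \<le> ereal (mm x (restrict (\<lambda>_. 0) {1..n+1}))"
    by (intro INF_lower) (auto simp: vectors_def)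
  ultimately show ?thesis
    by (cases "INF v\<in>vectors (n+1). ereal (mm x v)") auto
qed

text \<open>At each level the infimum is at most the value at \<open>v i\<close>, and an average
  over scenarios is at most their maximum.\<close>

lemma weak_duality:
  assumes w: "w \<in> prob_simplex"
  shows "MM x w \<le> ereal (mm x v)"
proof -
  have "(INF u. ereal (\<Sum>j\<in>UNIV. w $ j * psi i j x u)) \<le> ereal (mm x v)" if "i \<in> {1..n+1}" for i
  proof -
    have "(INF u. ereal (\<Sum>j\<in>UNIV. w $ j * psi i j x u)) \<le> ereal (\<Sum>j\<in>UNIV. w $ j * psi i j x (v i))"
      by (rule INF_lower) simp
    also have "(\<Sum>j\<in>UNIV. w $ j * psi i j x (v i)) \<le> (\<Sum>j\<in>UNIV. w $ j * mm x v)"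
      using that by (intro prob_simplex_sum_mono[OF w] mm_ge)
    finally show ?thesis by (simp add: prob_simplex_sum_const[OF w])
  qed
  then show ?thesis
    unfolding max_min_objective_def by (subst Max_le_iff) auto
qed

lemma strong_duality:
  assumes c: "(INF v\<in>vectors (n+1). ereal (mm x v)) = ereal c"
  obtains w where "w \<in> prob_simplex" "MM x w = ereal c"
proof -
  have "\<exists>i\<in>{1..n+1}. \<forall>v. \<exists>j. c \<le> psi i j x v"
  proof (rule ccontr)
    assume "\<not> ?thesis"
    then have "\<forall>i\<in>{1..n+1}. \<exists>v. \<forall>j. psi i j x v < c"
      by (meson not_le)
    then obtain v where v: "\<And>i j. i \<in> {1..n+1} \<Longrightarrow> psi i j x (v i) < c"
      by metis
    \<comment> \<open>Strictness survives because the maximum is over finitely many pairs.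
      \<open>restrict\<close> makes the vector extensional, as membership in \<open>vectors\<close>
      demands.\<close>
    then have "mm x (restrict v {1..n+1}) < c"
      by (auto simp: mm_less_iff)
    moreover have "ereal c \<le> ereal (mm x (restrict v {1..n+1}))"
      unfolding c[symmetric] by (intro INF_lower) (auto simp: vectors_def)
    ultimately show False by simp
  qed
  then obtain i where i: "i \<in> {1..n+1}" "\<And>v. \<exists>j. c \<le> psi i j x v" by blast
  obtain w where w: "w \<in> prob_simplex" "\<And>v. c \<le> (\<Sum>j\<in>UNIV. w $ j * psi i j x v)"
    using convex_minimax[of "\<lambda>j. psi i j x" c] psi_convex[OF i(1)] i(2) by metis
  have "ereal c \<le> (INF v. ereal (\<Sum>j\<in>UNIV. w $ j * psi i j x v))"
    using w(2) by (intro INF_greatest) simp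
  also have "\<dots> \<le> MM x w"
    unfolding max_min_objective_def using i(1) by (intro Max_ge) auto
  finally have "ereal c \<le> MM x w" .
  moreover have "MM x w \<le> ereal c"
    unfolding c[symmetric] by (intro INF_greatest weak_duality w)
  ultimately show ?thesis using w(1) that by (metis antisym)
qed

lemma minimax:
  assumes c: "(INF v\<in>vectors (n+1). ereal (mm x v)) = ereal c"
  shows "(SUP w\<in>prob_simplex. MM x w) = ereal c"
    and "\<exists>w. is_arg_max (MM x) (\<lambda>w. w \<in> prob_simplex) w"
proof -
  have le: "MM x w \<le> ereal c" if "w \<in> prob_simplex" for w
    unfolding c[symmetric] using that by (intro INF_greatest weak_duality)
  obtain w where w: "w \<in> prob_simplex" "MM x w = ereal c"
    by (rule strong_duality[OF c])
  show "(SUP w\<in>prob_simplex. MM x w) = ereal c"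
    using w le by (intro antisym SUP_least) (auto intro: SUP_upper2)
  show "\<exists>w. is_arg_max (MM x) (\<lambda>w. w \<in> prob_simplex) w"
    using w le by (force simp: is_arg_max_def not_less[symmetric])
qed

section \<open>Existence of optimal points\<close>

lemma inner_min_attained:
  assumes w: "w \<in> prob_simplex" and i: "i \<in> {1..n+1}" "\<alpha> i < 1"
  shows "\<exists>v. is_arg_min (\<lambda>v. \<Sum>j\<in>UNIV. w $ j * psi i j x v) (\<lambda>v. True) v"
proof -
  let ?g = "\<lambda>v. \<Sum>j\<in>UNIV. w $ j * psi i j x v"
  obtain a C where aC: "0 < a" "\<And>j v. a * v - C \<le> psi i j x v"
    using psi_coercive[OF i] by metis
  \<comment> \<open>A lower bound common to all scenarios passes to the average; it is applied below
    to \<open>- v\<close> and to \<open>a * v - C\<close>.\<close>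
  have ge: "b \<le> ?g v" if "\<And>j. b \<le> psi i j x v" for b v
    using prob_simplex_sum_mono[OF w, of "\<lambda>_. b" "\<lambda>j. psi i j x v"] that
    by (simp add: prob_simplex_sum_const[OF w])
  have "continuous_on UNIV ?g"
    by (intro continuous_intros psi_continuous i)
  then obtain v where "\<And>u. ?g v \<le> ?g u"
    by (rule coercive_attains_inf[OF _ aC(1) ge[OF psi_ge_minus[OF i(1)]] ge[OF aC(2)]]) blast
  then show ?thesis by (auto simp: is_arg_min_linorder)
qed

text \<open>The problem decouples: \<open>mm x v\<close> is the maximum over \<open>i\<close> of
  terms depending on \<open>v i\<close> alone, so minimising each coordinate separately gives an
  optimal vector.\<close>

lemma outer_min_attained:
  assumes "\<And>i. i \<in> {1..n+1} \<Longrightarrow> \<alpha> i < 1"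
  shows "\<exists>v. is_arg_min (mm x) (\<lambda>v. v \<in> vectors (n+1)) v"
proof -
  let ?h = "\<lambda>i v. MAX j\<in>UNIV. psi i j x v"
  have psi_le: "psi i j x v \<le> ?h i v" for i j v by simp
  have "\<exists>v. \<forall>u. ?h i v \<le> ?h i u" if i: "i \<in> {1..n+1}" for i
  proof -
    obtain a C where aC: "0 < a" "\<And>j v. a * v - C \<le> psi i j x v"
      using psi_coercive[OF i assms[OF i]] by metis
    have "continuous_on UNIV (?h i)"
      by (intro continuous_on_Max psi_continuous i) auto
    moreover have "- v \<le> ?h i v" for v
      using psi_ge_minus[OF i] psi_le[of i undefined v] by (rule order_trans)
    moreover have "a * v - C \<le> ?h i v" for v
      using aC(2) psi_le[of i undefined v] by (rule order_trans)
    ultimately show ?thesis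
      using coercive_attains_inf[of "?h i" a C] aC(1) by blast
  qed
  then obtain v where v: "\<And>i u. i \<in> {1..n+1} \<Longrightarrow> ?h i (v i) \<le> ?h i u" by metis
  have "mm x (restrict v {1..n+1}) \<le> mm x u" for u
    unfolding mm_le_iff
  proof (intro allI ballI)
    fix j i assume i: "i \<in> {1..n+1}"
    have "psi i j x (v i) \<le> ?h i (u i)"
      using psi_le v[OF i] by (rule order_trans)
    also have "\<dots> \<le> mm x u"
      using i by (subst Max_le_iff) (auto intro: mm_ge)
    finally show "psi i j x (restrict v {1..n+1} i) \<le> mm x u" using i by simp
  qed
  then show ?thesis
    by (intro exI[of _ "restrict v {1..n+1}"]) (auto simp: is_arg_min_linorder vectors_def)
qed

lemma robust_min_attained:
  assumes ne: "simplex_mix P R \<mu> \<noteq> {}"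
  shows "\<exists>x. is_arg_min (\<lambda>x. INF v\<in>vectors (n+1). ereal (mm x v)) (\<lambda>x. x \<in> simplex_mix P R \<mu>) x"
proof -
  obtain c where c: "\<And>x. (INF v\<in>vectors (n+1). ereal (mm x v)) = ereal (c x)"
    using primal_value by metis
  obtain L where L: "0 \<le> L"
    "\<And>i j x y v. i \<in> {1..n+1} \<Longrightarrow> psi i j x v \<le> psi i j y v + L * norm (x - y)"
    by (rule psi_Lipschitz) blast
  have c_le: "c x \<le> c y + L * norm (x - y)" for x y
  proof -
    \<comment> \<open>The Lipschitz term stands on the left so that the left side is free of
      \<open>v\<close> and the infimum over \<open>v\<close> can be taken on the right.\<close>
    have "ereal (c x - L * norm (x - y)) \<le> ereal (mm y v)" if "v \<in> vectors (n+1)" for v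
    proof -
      have "ereal (c x) \<le> ereal (mm x v)"
        unfolding c[symmetric] using that by (rule INF_lower)
      moreover have "mm x v \<le> mm y v + L * norm (x - y)"
        unfolding mm_le_iff
      proof (intro allI ballI)
        fix j i assume i: "i \<in> {1..n+1}"
        show "psi i j x (v i) \<le> mm y v + L * norm (x - y)"
          using L(2)[OF i, of j x "v i" y] mm_ge[OF i, of j y v] by linarith
      qed
      ultimately show ?thesis by simp
    qed
    then have "ereal (c x - L * norm (x - y)) \<le> ereal (c y)"
      unfolding c[symmetric] by (rule INF_greatest)
    then show ?thesis by simp
  qed
  have "L-lipschitz_on UNIV c"
  proof (rule lipschitz_onI)
    show "dist (c x) (c y) \<le> L * dist x y" for x y
      using c_le[of x y] c_le[of y x] by (auto simp: dist_norm norm_minus_commute abs_le_iff)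
  qed (rule L)
  then have "continuous_on (simplex_mix P R \<mu>) c"
    by (meson continuous_on_subset lipschitz_on_continuous_on subset_UNIV)
  then obtain x where "x \<in> simplex_mix P R \<mu>" "\<And>y. y \<in> simplex_mix P R \<mu> \<Longrightarrow> c x \<le> c y"
    using continuous_attains_inf[OF compact_simplex_mix ne] by metis
  then show ?thesis
    unfolding c by (auto simp: is_arg_min_linorder)
qed

end

text \<open>Equal optimal values alone would not make the two problems equivalent, so their optimal
  \<open>x\<close> are compared too. Attainment in \<open>v\<close> is tied to levels below 1: for
  \<open>\<alpha> i = 1\<close>, which can occur only at the last level, \<open>Psi\<close> is
  nonincreasing in \<open>v\<close> and may only approach its infimum.\<close>

theorem theorem2:
  fixes F :: "'a measure"
    and P :: "'m::finite \<Rightarrow> 'a measure"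
    and R :: "'k::finite \<Rightarrow> 'a \<Rightarrow> real"
    and Z :: "'a \<Rightarrow> real"
    and \<alpha> r :: "nat \<Rightarrow> real"
    and n :: nat
  assumes "\<And>j. prob_space (P j)"
    and "\<And>j. sets (P j) = sets F"
    and "\<And>k. R k \<in> borel_measurable F"
    and "Z \<in> borel_measurable F"
    and "\<And>j k. integrable (P j) (R k)"
    and "\<And>j. integrable (P j) Z"
    and "0 < \<alpha> 1" and "strict_mono_on {1..n+1} \<alpha>" and "\<alpha> (n+1) \<le> 1"
    and "0 < r 1" and "strict_mono_on {1..n+1} r" and "r (n+1) = 1"
  shows
    "(\<forall>x\<in>prob_simplex.
        (SUP w\<in>prob_simplex. max_min_objective P R Z \<alpha> r n x w)
          = (INF v\<in>vectors (n+1). ereal (min_max_objective P R Z \<alpha> r n x v))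
      \<and> \<bar>SUP w\<in>prob_simplex. max_min_objective P R Z \<alpha> r n x w\<bar> \<noteq> \<infinity>
      \<and> (\<exists>w. is_arg_max (max_min_objective P R Z \<alpha> r n x) (\<lambda>w. w \<in> prob_simplex) w)
      \<and> (\<forall>w\<in>prob_simplex. \<forall>i\<in>{1..n+1}. \<alpha> i < 1 \<longrightarrow>
            (\<exists>v. is_arg_min (\<lambda>v. \<Sum>j\<in>UNIV. w $ j * Psi P R Z \<alpha> r i j x v) (\<lambda>v. True) v))
      \<and> (\<alpha> (n+1) < 1 \<longrightarrow>
            (\<exists>v. is_arg_min (min_max_objective P R Z \<alpha> r n x) (\<lambda>v. v \<in> vectors (n+1)) v)))
   \<and> (\<forall>\<mu>.
        (INF x\<in>simplex_mix P R \<mu>. SUP w\<in>prob_simplex. max_min_objective P R Z \<alpha> r n x w)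
          = (INF x\<in>simplex_mix P R \<mu>. INF v\<in>vectors (n+1).
                ereal (min_max_objective P R Z \<alpha> r n x v))
      \<and> (\<forall>x. is_arg_min (\<lambda>x. SUP w\<in>prob_simplex. max_min_objective P R Z \<alpha> r n x w)
                (\<lambda>x. x \<in> simplex_mix P R \<mu>) x
            \<longleftrightarrow> is_arg_min (\<lambda>x. INF v\<in>vectors (n+1). ereal (min_max_objective P R Z \<alpha> r n x v))
                (\<lambda>x. x \<in> simplex_mix P R \<mu>) x)
      \<and> (simplex_mix P R \<mu> \<noteq> {} \<longrightarrow>
            (\<exists>x. is_arg_min (\<lambda>x. SUP w\<in>prob_simplex. max_min_objective P R Z \<alpha> r n x w)
                (\<lambda>x. x \<in> simplex_mix P R \<mu>) x)))"
proof -
  have mono: "\<alpha> i \<le> \<alpha> k" if "i \<in> {1..n+1}" "k \<in> {1..n+1}" "i \<le> k" for i k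
    using strict_mono_on_leD[OF assms(8)] that by blast
  have pos: "0 < \<alpha> i" if "i \<in> {1..n+1}" for i
    using mono[of 1 i] that assms(7) by auto
  have le_last: "\<alpha> i \<le> \<alpha> (n+1)" if "i \<in> {1..n+1}" for i
    using mono[of i "n+1"] that by auto
  have le_1: "\<alpha> i \<le> 1" if "i \<in> {1..n+1}" for i
    using le_last[OF that] assms(9) by linarith
  interpret scenario_model P R Z \<alpha> r n
    by (rule scenario_model.intro) (fact assms pos le_1)+
  have eq: "(SUP w\<in>prob_simplex. MM x w) = (INF v\<in>vectors (n+1). ereal (mm x v))"
    and fin: "\<bar>INF v\<in>vectors (n+1). ereal (mm x v)\<bar> \<noteq> \<infinity>"
    and att: "\<exists>w. is_arg_max (MM x) (\<lambda>w. w \<in> prob_simplex) w" for x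
  proof -
    obtain c where c: "(INF v\<in>vectors (n+1). ereal (mm x v)) = ereal c"
      using primal_value by blast
    show "(SUP w\<in>prob_simplex. MM x w) = (INF v\<in>vectors (n+1). ereal (mm x v))"
      "\<bar>INF v\<in>vectors (n+1). ereal (mm x v)\<bar> \<noteq> \<infinity>"
      "\<exists>w. is_arg_max (MM x) (\<lambda>w. w \<in> prob_simplex) w"
      using minimax[OF c] c by simp_all
  qed
  have outer: "\<exists>v. is_arg_min (mm x) (\<lambda>v. v \<in> vectors (n+1)) v" if "\<alpha> (n+1) < 1" for x
    by (rule outer_min_attained) (rule le_less_trans[OF le_last that])
  show ?thesis
    \<comment> \<open>\<open>eq\<close> holds for every \<open>x\<close>, so it rewrites under the
      binders over \<open>simplex_mix\<close> as well, and the comparisons of the two problems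
      become reflexive.\<close>
    unfolding eq
    by (intro conjI ballI allI impI refl fin att outer inner_min_attained robust_min_attained)
qed

end
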